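(* For every $p\in[1/2,1)$ there is a constant $C_p>0$ depending only on $p$ such that the following holds. Let $n$ be a positive integer, $A>0$, and let $f\colon\{0,1\}^n\to\{0,1\}$ satisfy $\mathbb{E}_x[s_f(x)^p]\leq A$. Then for all $\varepsilon\in(0,1]$, $$\Pr_{(x,y)\ (1-\varepsilon)\text{-correlated}}\left[f(x)=f(y)\right]\;\geq\;1-C_p\cdot A\cdot\varepsilon^{p}.$$
   Context: In $\mathbb{E}_x$, $x$ is uniformly distributed over $\{0,1\}^n$. The sensitivity $s_f(x)$ of $f$ at $x$ is the number of coordinates $i\in[n]=\{1,\dots,n\}$ such that $f(x\oplus e_i)\neq f(x)$, where $x\oplus e_i$ is $x$ with its $i$th bit flipped. A pair $(x,y)$ is $(1-\varepsilon)$-correlated if $x\in\{0,1\}^n$ is uniform and, for each $i\in[n]$ independently, $y_i=x_i$ with probability $1-\varepsilon$ and otherwise $y_i\in\{0,1\}$ is resampled uniformly. *)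

theory Defs
  imports "HOL-Probability.Probability" "HOL-Library.Monad_Syntax"
begin

text \<open>
  A point of the cube \<open>{0,1}\<^sup>n\<close> is a function \<open>nat \<Rightarrow> bool\<close> (bits as truth values) that is
  \<open>False\<close> outside \<open>{1..n}\<close>; this makes \<open>cube n\<close> a finite set with \<open>2 ^ n\<close> elements, and it is the
  convention of \<^const>\<open>Pi_pmf\<close> with default value \<open>False\<close>.
  Boolean functions are total on \<open>nat \<Rightarrow> bool\<close>, but only their values on \<open>cube n\<close> are ever used.
\<close>

definition cube :: "nat \<Rightarrow> (nat \<Rightarrow> bool) set" where
  "cube n = PiE_dflt {1..n} False (\<lambda>_. UNIV)"

definition flip :: "nat \<Rightarrow> (nat \<Rightarrow> bool) \<Rightarrow> (nat \<Rightarrow> bool)" where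
  "flip i x = x(i := \<not> x i)"

definition sensitivity :: "nat \<Rightarrow> ((nat \<Rightarrow> bool) \<Rightarrow> bool) \<Rightarrow> (nat \<Rightarrow> bool) \<Rightarrow> nat" where
  "sensitivity n f x = card {i \<in> {1..n}. f (flip i x) \<noteq> f x}"

definition noisy_bit :: "real \<Rightarrow> bool \<Rightarrow> bool pmf" where
  "noisy_bit \<epsilon> b = do {
     keep \<leftarrow> bernoulli_pmf (1 - \<epsilon>);
     if keep then return_pmf b else pmf_of_set UNIV
   }"

text \<open>The joint law of a \<open>(1 - \<epsilon>)\<close>-correlated pair; the parameter is the noise rate \<open>\<epsilon>\<close>.\<close>

definition correlated_pair :: "nat \<Rightarrow> real \<Rightarrow> ((nat \<Rightarrow> bool) \<times> (nat \<Rightarrow> bool)) pmf" where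
  "correlated_pair n \<epsilon> = do {
     x \<leftarrow> pmf_of_set (cube n);
     y \<leftarrow> Pi_pmf {1..n} False (\<lambda>i. noisy_bit \<epsilon> (x i));
     return_pmf (x, y)
   }"

end

theory Submission
  imports Defs
begin

(* With F = 1 - 2 f, the agreement probability is (1 + phi (1 - eps)) / 2, where phi rho is the
   noise stability of F at correlation rho, and phi 1 = 1. The derivative phi' rho is the mean over x
   of the sum, over the sensitive coordinates i of x, of +- E_y [F y * h_i y], where y is the
   rho-noisy copy of x and h_i is the derivative of the log-likelihood of y_i in rho. Under the law
   of y the h_i are orthogonal with E h_i^2 = 1 / (1 - rho^2), and E |h_i| = 1. With s the
   sensitivity at x and d = 1 - rho, the inner sum is therefore at most s and, by Cauchy-Schwarz, at
   most sqrt (s / d); hence at most s^p d^(p - 1). Integrating over d in (0, eps) gives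
   1 - phi (1 - eps) <= A eps^p / p, so C = 1 works. *)

section \<open>Noise kernel, its score, and noise stability\<close>

definition agree :: "bool \<Rightarrow> bool \<Rightarrow> real" where
  "agree a b = (if a = b then 1 else - 1)"

text \<open>Transition probability of one bit at correlation \<rho>: a kept bit agrees and a
  resampled one agrees half of the time, so agreement has probability
  \<open>\<rho> + (1 - \<rho>) / 2\<close>.\<close>

definition kern :: "real \<Rightarrow> bool \<Rightarrow> bool \<Rightarrow> real" where
  "kern \<rho> a b = (1 + \<rho> * agree a b) / 2"

text \<open>The derivative of \<open>ln (kern \<rho> a b)\<close> in \<rho>. The denominator
  vanishes for disagreeing bits at \<open>\<rho> = 1\<close>, hence the recurring assumption
  \<open>\<rho> < 1\<close>.\<close>

definition score :: "real \<Rightarrow> bool \<Rightarrow> bool \<Rightarrow> real" where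
  "score \<rho> a b = agree a b / (1 + \<rho> * agree a b)"

definition cube_kern :: "nat \<Rightarrow> real \<Rightarrow> (nat \<Rightarrow> bool) \<Rightarrow> (nat \<Rightarrow> bool) \<Rightarrow> real" where
  "cube_kern n \<rho> x y = (\<Prod>i\<in>{1..n}. kern \<rho> (x i) (y i))"

definition spin :: "bool \<Rightarrow> real" where
  "spin b = (if b then - 1 else 1)"

definition stab :: "nat \<Rightarrow> ((nat \<Rightarrow> bool) \<Rightarrow> bool) \<Rightarrow> real \<Rightarrow> real" where
  "stab n f \<rho> = (\<Sum>x\<in>cube n. \<Sum>y\<in>cube n. spin (f x) * spin (f y) * cube_kern n \<rho> x y) / 2 ^ n"

text \<open>Inner product of the sign form of \<open>f\<close> with the score of coordinate
  \<open>i\<close>, in the L2 space of the law of the noisy copy of \<open>x\<close>.\<close>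

definition score_coeff :: "nat \<Rightarrow> ((nat \<Rightarrow> bool) \<Rightarrow> bool) \<Rightarrow> real \<Rightarrow> nat \<Rightarrow> (nat \<Rightarrow> bool) \<Rightarrow> real" where
  "score_coeff n f \<rho> i x =
     (\<Sum>y\<in>cube n. spin (f y) * (cube_kern n \<rho> x y * score \<rho> (x i) (y i)))"

section \<open>Sums over the cube\<close>

lemma finite_cube [simp]: "finite (cube n)"
  unfolding cube_def by (rule finite_PiE_dflt) auto

lemma card_cube: "card (cube n) = 2 ^ n"
  unfolding cube_def by (subst card_PiE_dflt) auto

lemma cube_nonempty [simp]: "cube n \<noteq> {}"
  by (simp add: cube_def)

lemma flip_flip [simp]: "flip i (flip i x) = x"
  by (simp add: flip_def)

lemma flip_in_cube: "i \<in> {1..n} \<Longrightarrow> x \<in> cube n \<Longrightarrow> flip i x \<in> cube n"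
  by (auto simp: cube_def PiE_dflt_def flip_def)

text \<open>Distributivity; it reduces every expectation under the product law of the noisy copy to
  one-coordinate sums.\<close>

lemma sum_cube_prod:
  fixes g :: "nat \<Rightarrow> bool \<Rightarrow> real"
  shows "(\<Sum>y\<in>cube n. \<Prod>i\<in>{1..n}. g i (y i)) = (\<Prod>i\<in>{1..n}. g i False + g i True)"
proof -
  \<comment> \<open>Points of the cube are \<open>False\<close> outside \<open>{1..n}\<close>,
    whereas \<open>prod_sum_PiE\<close> sums over functions that are \<open>undefined\<close> there;
    \<open>?E\<close> translates.\<close>
  let ?E = "\<lambda>h x. if x \<in> {1..n} then h x else False"
  have "inj_on ?E (PiE {1..n} (\<lambda>_. UNIV))"
  proof (rule inj_onI)
    fix g h :: "nat \<Rightarrow> bool"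
    assume gh: "g \<in> PiE {1..n} (\<lambda>_. UNIV)" "h \<in> PiE {1..n} (\<lambda>_. UNIV)" and eq: "?E g = ?E h"
    have "g i = h i" if "i \<in> {1..n}" for i
      using fun_cong [OF eq, of i] that by simp
    then show "g = h" using gh by (intro PiE_ext)
  qed
  then have "(\<Sum>y\<in>cube n. \<Prod>i\<in>{1..n}. g i (y i)) =
      (\<Sum>h\<in>PiE {1..n} (\<lambda>_. UNIV). \<Prod>i\<in>{1..n}. g i (?E h i))"
    unfolding cube_def by (subst dflt_image_PiE [symmetric]) (simp add: sum.reindex)
  also have "\<dots> = (\<Sum>h\<in>PiE {1..n} (\<lambda>_. UNIV). \<Prod>i\<in>{1..n}. g i (h i))"
    by (intro sum.cong prod.cong) auto
  also have "\<dots> = (\<Prod>i\<in>{1..n}. \<Sum>b\<in>UNIV. g i b)"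
    by (rule prod_sum_PiE [symmetric]) auto
  finally show ?thesis by (simp add: UNIV_bool add.commute)
qed

section \<open>Elementary properties of the kernel\<close>

lemma spin_square [simp]: "spin b * spin b = 1"
  by (simp add: spin_def)

lemma abs_spin [simp]: "\<bar>spin b\<bar> = 1"
  by (simp add: spin_def)

lemma kern_pos: "0 \<le> \<rho> \<Longrightarrow> \<rho> < 1 \<Longrightarrow> 0 < kern \<rho> a b"
  by (simp add: kern_def agree_def)

text \<open>The kernel cancels the denominator of the score and leaves its own derivative in \<rho>,
  which is 1/2 up to sign. This yields both the vanishing mean and the unit absolute mean of the
  score.\<close>

lemma kern_score:
  assumes "0 \<le> \<rho>" "\<rho> < 1"
  shows "kern \<rho> a b * score \<rho> a b = agree a b / 2"
proof -
  have "1 + \<rho> * agree a b \<noteq> 0" using assms by (simp add: agree_def)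
  then show ?thesis unfolding kern_def score_def by (metis nonzero_mult_div_cancel_left
    times_divide_eq_left times_divide_eq_right)
qed

lemma cube_kern_nonneg: "0 \<le> \<rho> \<Longrightarrow> \<rho> < 1 \<Longrightarrow> 0 \<le> cube_kern n \<rho> x y"
  unfolding cube_kern_def using kern_pos by (intro prod_nonneg) (auto intro: less_imp_le)

lemma sum_cube_kern: "(\<Sum>y\<in>cube n. cube_kern n \<rho> x y) = 1"
  unfolding cube_kern_def
  by (subst sum_cube_prod) (intro prod.neutral, auto simp: kern_def agree_def field_simps)

lemma cube_kern_one:
  assumes "x \<in> cube n" "y \<in> cube n"
  shows "cube_kern n 1 x y = (if y = x then 1 else 0)"
proof (cases "y = x")
  case False
  then obtain i where i: "y i \<noteq> x i" by (auto simp: fun_eq_iff)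
  \<comment> \<open>Both points are \<open>False\<close> outside \<open>{1..n}\<close>, so they can
    differ only inside; there the kernel has a zero factor.\<close>
  then have "i \<in> {1..n}" using assms by (auto simp: cube_def PiE_dflt_def)
  then have "cube_kern n 1 x y = 0"
    unfolding cube_kern_def using i by (intro prod_zero) (auto simp: kern_def agree_def)
  then show ?thesis using False by simp
qed (simp add: cube_kern_def kern_def agree_def)

lemma stab_one: "stab n f 1 = 1"
proof -
  have "stab n f 1 = (\<Sum>x\<in>cube n. \<Sum>y\<in>cube n. if y = x then 1 else 0) / 2 ^ n"
    unfolding stab_def
    by (intro arg_cong2 [where f = "(/)"] sum.cong refl) (simp add: cube_kern_one)
  then show ?thesis by (simp add: card_cube)
qed

section \<open>Moments of the score\<close>

text \<open>Distinct coordinates are independent and each score has mean zero. On the diagonal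
  stands the Fisher information of one bit, the mean of \<open>1 / (1 + \<rho>)\<close> and
  \<open>1 / (1 - \<rho>)\<close>.\<close>

lemma score_orthogonal:
  assumes "0 \<le> \<rho>" "\<rho> < 1" "i \<in> {1..n}" "j \<in> {1..n}"
  shows "(\<Sum>y\<in>cube n. cube_kern n \<rho> x y * (score \<rho> (x i) (y i) * score \<rho> (x j) (y j))) =
         (if i = j then 1 / (1 - \<rho>\<^sup>2) else 0)"
proof -
  \<comment> \<open>The two conditionals stay separate so that for \<open>i = j\<close> the score
    enters squared.\<close>
  define g where "g k b = kern \<rho> (x k) b *
    ((if k = i then score \<rho> (x k) b else 1) * (if k = j then score \<rho> (x k) b else 1))" for k b
  have "(\<Sum>y\<in>cube n. cube_kern n \<rho> x y * (score \<rho> (x i) (y i) * score \<rho> (x j) (y j))) =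
      (\<Sum>y\<in>cube n. \<Prod>k\<in>{1..n}. g k (y k))"
    using assms(3,4) by (simp add: cube_kern_def g_def prod.distrib)
  also have "\<dots> = (\<Prod>k\<in>{1..n}. g k False + g k True)"
    by (rule sum_cube_prod)
  also have "\<dots> = (if i = j then 1 / (1 - \<rho>\<^sup>2) else 0)"
  proof (cases "i = j")
    case True
    have nz: "1 - \<rho> \<noteq> 0" "1 + \<rho> \<noteq> 0" using assms by auto
    have sq: "1 - \<rho>\<^sup>2 = (1 - \<rho>) * (1 + \<rho>)" by (simp add: power2_eq_square algebra_simps)
    have half: "1 / ((1 + \<rho>) * 2) + 1 / ((1 - \<rho>) * 2) = 1 / (1 - \<rho>\<^sup>2)"
    proof -
      have "1 / (a * 2) + 1 / (b * 2) = (a + b) / (2 * (b * a))"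
        if "a \<noteq> 0" "b \<noteq> 0" for a b :: real
        using that by (simp add: field_simps)
      from this [OF nz(2,1)] show ?thesis unfolding sq by simp
    qed
    have gi: "g i b = agree (x i) b / 2 * score \<rho> (x i) b" for b
      by (simp add: g_def True kern_score [OF assms(1,2)] flip: mult.assoc)
    have "g i False + g i True = 1 / (1 - \<rho>\<^sup>2)"
      unfolding gi half [symmetric] by (cases "x i") (simp_all add: agree_def score_def mult.commute)
    moreover have "g k False + g k True = 1" if "k \<noteq> i" for k
      using that by (cases "x k") (simp_all add: g_def True kern_def agree_def field_simps)
    ultimately have "g k False + g k True = (if k = i then 1 / (1 - \<rho>\<^sup>2) else 1)" for k
      by simp
    then show ?thesis using True assms by simp
  next
    case False
    have "g i False + g i True = 0"
      using False by (simp add: g_def kern_score [OF assms(1,2)] agree_def)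
    then have "(\<Prod>k\<in>{1..n}. g k False + g k True) = 0"
      using assms by (intro prod_zero) auto
    then show ?thesis using False by simp
  qed
  finally show ?thesis .
qed

text \<open>By \<open>kern_score\<close> each value of bit \<open>i\<close> contributes exactly 1/2,
  and the other coordinates carry total mass 1.\<close>

lemma sum_abs_score:
  assumes "0 \<le> \<rho>" "\<rho> < 1" "i \<in> {1..n}"
  shows "(\<Sum>y\<in>cube n. cube_kern n \<rho> x y * \<bar>score \<rho> (x i) (y i)\<bar>) = 1"
proof -
  define g where "g k b = kern \<rho> (x k) b * (if k = i then \<bar>score \<rho> (x k) b\<bar> else 1)" for k b
  have "(\<Sum>y\<in>cube n. cube_kern n \<rho> x y * \<bar>score \<rho> (x i) (y i)\<bar>) =
      (\<Sum>y\<in>cube n. \<Prod>k\<in>{1..n}. g k (y k))"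
    using assms(3) by (simp add: cube_kern_def g_def prod.distrib)
  also have "\<dots> = (\<Prod>k\<in>{1..n}. g k False + g k True)"
    by (rule sum_cube_prod)
  also have "\<dots> = 1"
  proof (intro prod.neutral ballI)
    fix k
    have "g k b = (if k = i then 1 / 2 else kern \<rho> (x k) b)" for b
    proof (cases "k = i")
      case True
      have "g k b = \<bar>kern \<rho> (x k) b * score \<rho> (x k) b\<bar>"
        using kern_pos [OF assms(1,2), of "x k" b]
        by (simp only: g_def True if_True refl abs_mult abs_of_pos)
      then show ?thesis by (simp add: True kern_score [OF assms(1,2)] agree_def)
    qed (simp add: g_def)
    then have "g k False + g k True =
        (if k = i then 1 else kern \<rho> (x k) False + kern \<rho> (x k) True)"
      by simp
    then show "g k False + g k True = 1"
      by (cases "x k") (simp_all add: kern_def agree_def field_simps)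
  qed
  finally show ?thesis .
qed

section \<open>Bounds on the score coefficients\<close>

text \<open>Triangle inequality with signs of modulus 1. Summed over the sensitive coordinates, this
  bounds the inner sum by the sensitivity.\<close>

lemma abs_score_coeff_le:
  assumes "0 \<le> \<rho>" "\<rho> < 1" "i \<in> {1..n}"
  shows "\<bar>score_coeff n f \<rho> i x\<bar> \<le> 1"
proof -
  have "\<bar>score_coeff n f \<rho> i x\<bar> \<le>
      (\<Sum>y\<in>cube n. \<bar>spin (f y) * (cube_kern n \<rho> x y * score \<rho> (x i) (y i))\<bar>)"
    unfolding score_coeff_def by (rule sum_abs)
  also have "\<dots> = (\<Sum>y\<in>cube n. cube_kern n \<rho> x y * \<bar>score \<rho> (x i) (y i)\<bar>)"
    using cube_kern_nonneg assms by (intro sum.cong) (auto simp: abs_mult)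
  finally show ?thesis using sum_abs_score [OF assms] by simp
qed

text \<open>Signs \<open>c i\<close> turn the sum of absolute values into one expectation of
  \<open>spin (f y) * Z y\<close>. By Cauchy-Schwarz its square is at most the second moment of
  \<open>Z\<close>, in which orthogonality leaves only the diagonal.\<close>

lemma sum_abs_score_coeff_square_le:
  assumes "0 \<le> \<rho>" "\<rho> < 1" "S \<subseteq> {1..n}"
  shows "(\<Sum>i\<in>S. \<bar>score_coeff n f \<rho> i x\<bar>)\<^sup>2 \<le> card S / (1 - \<rho>\<^sup>2)"
proof -
  have fin: "finite S" using assms(3) finite_subset by blast
  define c where "c i = (if score_coeff n f \<rho> i x < 0 then - 1 else (1::real))" for i
  define W where "W = cube_kern n \<rho> x"
  define h where "h i y = score \<rho> (x i) (y i)" for i and y :: "nat \<Rightarrow> bool"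
  define Z where "Z y = (\<Sum>i\<in>S. c i * h i y)" for y
  have W: "0 \<le> W y" for y using cube_kern_nonneg assms by (simp add: W_def)
  have "(\<Sum>i\<in>S. \<bar>score_coeff n f \<rho> i x\<bar>) = (\<Sum>i\<in>S. c i * score_coeff n f \<rho> i x)"
    by (intro sum.cong) (auto simp: c_def)
  also have "\<dots> = (\<Sum>y\<in>cube n. \<Sum>i\<in>S. c i * (spin (f y) * (W y * h i y)))"
    unfolding score_coeff_def sum_distrib_left W_def h_def by (rule sum.swap)
  \<comment> \<open>\<open>Cauchy_Schwarz_ineq_sum\<close> has no weights, so \<open>W y\<close> is
    split evenly between the two factors.\<close>
  also have "\<dots> = (\<Sum>y\<in>cube n. (spin (f y) * sqrt (W y)) * (sqrt (W y) * Z y))"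
  proof (intro sum.cong refl)
    fix y
    have "(\<Sum>i\<in>S. c i * (spin (f y) * (W y * h i y))) = spin (f y) * (W y * Z y)"
      by (simp add: Z_def sum_distrib_left mult_ac)
    also have "\<dots> = spin (f y) * (sqrt (W y) * sqrt (W y) * Z y)"
      using W by simp
    finally show "(\<Sum>i\<in>S. c i * (spin (f y) * (W y * h i y))) =
        (spin (f y) * sqrt (W y)) * (sqrt (W y) * Z y)"
      by (simp only: mult.assoc)
  qed
  finally have "(\<Sum>i\<in>S. \<bar>score_coeff n f \<rho> i x\<bar>)\<^sup>2 \<le>
      (\<Sum>y\<in>cube n. (spin (f y) * sqrt (W y))\<^sup>2) * (\<Sum>y\<in>cube n. (sqrt (W y) * Z y)\<^sup>2)"
    by (simp only: Cauchy_Schwarz_ineq_sum)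
  also have "(\<Sum>y\<in>cube n. (spin (f y) * sqrt (W y))\<^sup>2) = 1"
    using W sum_cube_kern [of n \<rho> x]
    by (simp add: power_mult_distrib power2_eq_square [of "spin _"] flip: W_def)
  also have "(\<Sum>y\<in>cube n. (sqrt (W y) * Z y)\<^sup>2) = (\<Sum>y\<in>cube n. W y * (Z y * Z y))"
    using W by (simp add: power_mult_distrib power2_eq_square [of "Z _"])
  also have "\<dots> = (\<Sum>y\<in>cube n. \<Sum>i\<in>S. \<Sum>j\<in>S. c i * c j * (W y * (h i y * h j y)))"
    unfolding Z_def sum_product unfolding sum_distrib_left by (simp add: mult_ac)
  also have "\<dots> = (\<Sum>i\<in>S. \<Sum>j\<in>S. c i * c j * (\<Sum>y\<in>cube n. W y * (h i y * h j y)))"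
    unfolding sum_distrib_left by (subst sum.swap, rule sum.cong, rule refl, rule sum.swap)
  also have "\<dots> = (\<Sum>i\<in>S. \<Sum>j\<in>S. if i = j then 1 / (1 - \<rho>\<^sup>2) else 0)"
  proof (intro sum.cong refl)
    fix i j assume "i \<in> S" "j \<in> S"
    then have "i \<in> {1..n}" "j \<in> {1..n}" using assms(3) by auto
    then show "c i * c j * (\<Sum>y\<in>cube n. W y * (h i y * h j y)) =
        (if i = j then 1 / (1 - \<rho>\<^sup>2) else 0)"
      unfolding W_def h_def score_orthogonal [OF assms(1,2) \<open>i \<in> {1..n}\<close> \<open>j \<in> {1..n}\<close>]
      by (simp add: c_def)
  qed
  also have "\<dots> = card S / (1 - \<rho>\<^sup>2)"
    using fin by simp
  finally show ?thesis by simp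
qed

text \<open>With \<open>u = s * \<delta>\<close>, the product \<open>T * \<delta>\<close> is at most
  \<open>u\<close> and at most \<open>sqrt u\<close>. The first is below \<open>u powr p\<close> if
  \<open>u \<le> 1\<close>, as \<open>p \<le> 1\<close>; the second is if \<open>u \<ge> 1\<close>,
  as \<open>p \<ge> 1 / 2\<close>.\<close>

lemma le_powr_interpolation:
  fixes s \<delta> p T :: real
  assumes "1 / 2 \<le> p" "p \<le> 1" "0 < \<delta>" "0 \<le> s" "T \<le> s" "T\<^sup>2 \<le> s / \<delta>"
  shows "T \<le> s powr p * \<delta> powr (p - 1)"
\<comment> \<open>For \<open>s = 0\<close> the right-hand side is 0, since
  \<open>0 powr p = 0\<close>, and \<open>T \<le> s\<close> suffices.\<close>
proof (cases "s = 0")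
  case False
  define u where "u = s * \<delta>"
  have u: "0 < u" using assms False by (simp add: u_def)
  have "T * \<delta> \<le> u powr p"
  proof (cases "u \<le> 1")
    case True
    have "T * \<delta> \<le> u powr 1" using assms u by (simp add: u_def)
    also have "\<dots> \<le> u powr p" using True u assms by (intro powr_mono') auto
    finally show ?thesis .
  next
    case False
    have "(T * \<delta>)\<^sup>2 = T\<^sup>2 * \<delta> * \<delta>" by (simp add: power2_eq_square)
    also have "\<dots> \<le> s / \<delta> * \<delta> * \<delta>"
      using assms by (intro mult_right_mono) auto
    also have "\<dots> = u" using assms by (simp add: u_def)
    finally have "T * \<delta> \<le> sqrt u" by (rule real_le_rsqrt)
    also have "\<dots> = u powr (1 / 2)" using u by (simp add: powr_half_sqrt)
    also have "\<dots> \<le> u powr p" using False assms by (intro powr_mono) auto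
    finally show ?thesis .
  qed
  then have "T \<le> u powr p / \<delta>" using assms by (simp add: field_simps)
  also have "\<dots> = s powr p * \<delta> powr (p - 1)"
    using assms by (simp add: u_def powr_mult powr_diff)
  finally show ?thesis .
qed (use assms in simp)

section \<open>The derivative of noise stability\<close>

text \<open>After the cancellation in \<open>kern_score\<close>, the summand depends on bit
  \<open>i\<close> of \<open>x\<close> only through the sign
  \<open>agree (x i) (y i)\<close>.\<close>

lemma score_coeff_flip:
  assumes "0 \<le> \<rho>" "\<rho> < 1" "i \<in> {1..n}"
  shows "score_coeff n f \<rho> i (flip i x) = - score_coeff n f \<rho> i x"
proof -
  have eq: "cube_kern n \<rho> z y * score \<rho> (z i) (y i) =
      agree (z i) (y i) / 2 * (\<Prod>j\<in>{1..n}-{i}. kern \<rho> (z j) (y j))" for z y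
  proof -
    have "cube_kern n \<rho> z y =
        kern \<rho> (z i) (y i) * (\<Prod>j\<in>{1..n}-{i}. kern \<rho> (z j) (y j))"
      unfolding cube_kern_def using assms(3) by (intro prod.remove) auto
    then show ?thesis
      unfolding kern_score [OF assms(1,2), symmetric] by (simp add: mult_ac)
  qed
  have "(\<Prod>j\<in>{1..n}-{i}. kern \<rho> (flip i x j) (y j)) = (\<Prod>j\<in>{1..n}-{i}. kern \<rho> (x j) (y j))" for y
    by (intro prod.cong) (auto simp: flip_def)
  moreover have "agree (flip i x i) b = - agree (x i) b" for b
    by (simp add: agree_def flip_def)
  ultimately show ?thesis
    unfolding score_coeff_def eq by (simp add: sum_negf)
qed

text \<open>Pairing \<open>x\<close> with \<open>flip i x\<close> and using antisymmetry replaces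
  \<open>spin (f x)\<close> by half its difference along coordinate \<open>i\<close>, which is 0
  where \<open>i\<close> is not sensitive and 1 or -1 where it is.\<close>

lemma sum_spin_score_coeff:
  assumes "0 \<le> \<rho>" "\<rho> < 1" "i \<in> {1..n}"
  shows "(\<Sum>x\<in>cube n. spin (f x) * score_coeff n f \<rho> i x) \<le>
         (\<Sum>x\<in>cube n. if f (flip i x) \<noteq> f x then \<bar>score_coeff n f \<rho> i x\<bar> else 0)"
proof -
  let ?G = "score_coeff n f \<rho> i"
  have bij: "bij_betw (flip i) (cube n) (cube n)"
    by (rule bij_betw_byWitness [where f' = "flip i"]) (auto intro: flip_in_cube [OF assms(3)])
  have "(\<Sum>x\<in>cube n. spin (f x) * ?G x) = (\<Sum>x\<in>cube n. spin (f (flip i x)) * ?G (flip i x))"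
    by (rule sum.reindex_bij_betw [OF bij, symmetric])
  then have anti: "(\<Sum>x\<in>cube n. spin (f x) * ?G x) = - (\<Sum>x\<in>cube n. spin (f (flip i x)) * ?G x)"
    by (simp only: score_coeff_flip [OF assms] mult_minus_right sum_negf)
  have half: "(\<Sum>x\<in>cube n. (spin (f x) - spin (f (flip i x))) / 2 * ?G x) =
      ((\<Sum>x\<in>cube n. spin (f x) * ?G x) - (\<Sum>x\<in>cube n. spin (f (flip i x)) * ?G x)) / 2"
    unfolding sum_subtractf [symmetric] sum_divide_distrib
    by (intro sum.cong refl) (simp add: algebra_simps)
  \<comment> \<open>The sum \<open>b\<close> is the negative of its flipped version
    \<open>c\<close>, hence equals half of \<open>b - c\<close>.\<close>
  have "b = - c \<Longrightarrow> a = (b - c) / 2 \<Longrightarrow> b = a" for a b c :: real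
    by simp
  from this [OF anti half] have "(\<Sum>x\<in>cube n. spin (f x) * ?G x) =
      (\<Sum>x\<in>cube n. (spin (f x) - spin (f (flip i x))) / 2 * ?G x)" .
  also have "\<dots> \<le> (\<Sum>x\<in>cube n. if f (flip i x) \<noteq> f x then \<bar>?G x\<bar> else 0)"
  proof (intro sum_mono)
    fix x
    show "(spin (f x) - spin (f (flip i x))) / 2 * ?G x \<le>
        (if f (flip i x) \<noteq> f x then \<bar>?G x\<bar> else 0)"
      by (cases "f x"; cases "f (flip i x)") (simp_all add: spin_def)
  qed
  finally show ?thesis .
qed

text \<open>The logarithmic derivative of a product is the sum of those of its factors, here the
  scores.\<close>

lemma stab_deriv:
  assumes "0 \<le> \<rho>" "\<rho> < 1"
  shows "(stab n f has_real_derivative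
    (\<Sum>i\<in>{1..n}. \<Sum>x\<in>cube n. spin (f x) * score_coeff n f \<rho> i x) / 2 ^ n) (at \<rho>)"
proof -
  have k: "((\<lambda>r. cube_kern n r x y) has_real_derivative
      cube_kern n \<rho> x y * (\<Sum>i\<in>{1..n}. score \<rho> (x i) (y i))) (at \<rho>)" for x y
  proof -
    have "((\<lambda>r. cube_kern n r x y) has_real_derivative
        cube_kern n \<rho> x y * (\<Sum>i\<in>{1..n}. (agree (x i) (y i) / 2) / kern \<rho> (x i) (y i))) (at \<rho>)"
      unfolding cube_kern_def
    proof (rule has_field_derivative_prod')
      show "kern \<rho> (x i) (y i) \<noteq> 0" for i
        using kern_pos [OF assms] by (metis less_irrefl)
      show "((\<lambda>r. kern r (x i) (y i)) has_real_derivative agree (x i) (y i) / 2) (at \<rho>)" for i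
        unfolding kern_def by (auto intro!: derivative_eq_intros)
    qed
    also have "(\<lambda>i. (agree (x i) (y i) / 2) / kern \<rho> (x i) (y i)) = (\<lambda>i. score \<rho> (x i) (y i))"
      by (simp add: kern_def score_def)
    finally show ?thesis .
  qed
  have "(stab n f has_real_derivative (\<Sum>x\<in>cube n. \<Sum>y\<in>cube n. spin (f x) * spin (f y) *
      (cube_kern n \<rho> x y * (\<Sum>i\<in>{1..n}. score \<rho> (x i) (y i)))) / 2 ^ n) (at \<rho>)"
    unfolding stab_def by (intro DERIV_cdivide DERIV_sum DERIV_cmult k)
  also have "(\<Sum>x\<in>cube n. \<Sum>y\<in>cube n. spin (f x) * spin (f y) *
      (cube_kern n \<rho> x y * (\<Sum>i\<in>{1..n}. score \<rho> (x i) (y i)))) =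
      (\<Sum>x\<in>cube n. \<Sum>y\<in>cube n. \<Sum>i\<in>{1..n}.
        spin (f x) * (spin (f y) * (cube_kern n \<rho> x y * score \<rho> (x i) (y i))))"
    by (simp add: sum_distrib_left mult_ac)
  also have "\<dots> = (\<Sum>x\<in>cube n. \<Sum>i\<in>{1..n}. spin (f x) * score_coeff n f \<rho> i x)"
    unfolding score_coeff_def sum_distrib_left by (rule sum.cong, rule refl, rule sum.swap)
  also have "\<dots> = (\<Sum>i\<in>{1..n}. \<Sum>x\<in>cube n. spin (f x) * score_coeff n f \<rho> i x)"
    by (rule sum.swap)
  finally show ?thesis .
qed

lemma stab_deriv_le:
  assumes "0 \<le> \<rho>" "\<rho> < 1" "1 / 2 \<le> p" "p \<le> 1"
  shows "(\<Sum>i\<in>{1..n}. \<Sum>x\<in>cube n. spin (f x) * score_coeff n f \<rho> i x) / 2 ^ n \<le>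
    (\<Sum>x\<in>cube n. real (sensitivity n f x) powr p) / 2 ^ n * (1 - \<rho>) powr (p - 1)"
proof -
  define S where "S x = {i \<in> {1..n}. f (flip i x) \<noteq> f x}" for x
  have "(\<Sum>i\<in>{1..n}. \<Sum>x\<in>cube n. spin (f x) * score_coeff n f \<rho> i x) \<le>
      (\<Sum>i\<in>{1..n}. \<Sum>x\<in>cube n. if f (flip i x) \<noteq> f x then \<bar>score_coeff n f \<rho> i x\<bar> else 0)"
    by (intro sum_mono sum_spin_score_coeff assms)
  \<comment> \<open>Grouping by \<open>x\<close> collects its sensitive coordinates, so the two
    bounds on score coefficients apply to \<open>S x\<close>.\<close>
  also have "\<dots> = (\<Sum>x\<in>cube n. \<Sum>i\<in>S x. \<bar>score_coeff n f \<rho> i x\<bar>)"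
    unfolding S_def by (subst sum.swap, intro sum.cong refl sum.inter_filter [symmetric]) auto
  also have "\<dots> \<le> (\<Sum>x\<in>cube n. real (sensitivity n f x) powr p * (1 - \<rho>) powr (p - 1))"
  proof (intro sum_mono)
    fix x
    let ?T = "\<Sum>i\<in>S x. \<bar>score_coeff n f \<rho> i x\<bar>"
    have S: "S x \<subseteq> {1..n}" "real (card (S x)) = real (sensitivity n f x)"
      by (auto simp: S_def sensitivity_def)
    have "?T \<le> (\<Sum>i\<in>S x. 1)"
      using S(1) by (intro sum_mono abs_score_coeff_le assms) auto
    then have T1: "?T \<le> real (sensitivity n f x)" using S(2) by simp
    \<comment> \<open>Dropping the factor \<open>1 + \<rho>\<close>, which lies between 1 and 2,
      leaves a pure power of the distance to 1.\<close>
    have "1 - \<rho> \<le> 1 - \<rho>\<^sup>2"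
      using assms by (simp add: power2_eq_square mult_left_le)
    then have "real (sensitivity n f x) / (1 - \<rho>\<^sup>2) \<le> real (sensitivity n f x) / (1 - \<rho>)"
      using assms by (intro divide_left_mono mult_pos_pos) auto
    with sum_abs_score_coeff_square_le [OF assms(1,2) S(1), of f x]
    have T2: "?T\<^sup>2 \<le> real (sensitivity n f x) / (1 - \<rho>)"
      using S(2) by simp
    show "?T \<le> real (sensitivity n f x) powr p * (1 - \<rho>) powr (p - 1)"
      by (rule le_powr_interpolation) (use assms T1 T2 in auto)
  qed
  finally show ?thesis by (simp add: divide_right_mono flip: sum_distrib_right)
qed

section \<open>Integration of the derivative bound\<close>

lemma continuous_on_stab: "continuous_on X (stab n f)"
  unfolding stab_def cube_kern_def kern_def by (intro continuous_intros) auto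

text \<open>Integration is replaced by monotonicity: adding the antiderivative term
  \<open>B * (1 - \<rho>) powr p / p\<close> to the stability gives a nonincreasing function
  \<open>u\<close>, compared at the two ends.\<close>

lemma one_minus_stab_le:
  fixes p \<epsilon> :: real
  assumes "1 / 2 \<le> p" "p \<le> 1" "0 < \<epsilon>" "\<epsilon> \<le> 1"
  shows "1 - stab n f (1 - \<epsilon>) \<le>
    (\<Sum>x\<in>cube n. real (sensitivity n f x) powr p) / 2 ^ n * \<epsilon> powr p / p"
proof -
  define B where "B = (\<Sum>x\<in>cube n. real (sensitivity n f x) powr p) / 2 ^ n"
  define u where "u \<rho> = stab n f \<rho> + B * (1 - \<rho>) powr p / p" for \<rho>
  have "u 1 \<le> u (1 - \<epsilon>)"
  \<comment> \<open>The open version asks only for continuity at 1, where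
    \<open>(1 - \<rho>) powr (p - 1)\<close> blows up as \<rho> tends to 1 if
    \<open>p < 1\<close>.\<close>
  proof (rule DERIV_nonpos_imp_decreasing_open [of _ _ u])
    show "1 - \<epsilon> \<le> 1" using assms by simp
    show "continuous_on {1 - \<epsilon>..1} u"
      unfolding u_def using assms
      by (intro continuous_intros continuous_on_stab continuous_on_powr') auto
    fix \<rho> assume r: "1 - \<epsilon> < \<rho>" "\<rho> < 1"
    then have r0: "0 \<le> \<rho>" using assms by simp
    define D where "D = (\<Sum>i\<in>{1..n}. \<Sum>x\<in>cube n. spin (f x) * score_coeff n f \<rho> i x) / 2 ^ n"
    have "((\<lambda>\<rho>. (1 - \<rho>) powr p) has_real_derivative - (p * (1 - \<rho>) powr (p - 1))) (at \<rho>)"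
      using r by (auto intro!: derivative_eq_intros simp: powr_diff field_simps)
    then have "((\<lambda>\<rho>. B * (1 - \<rho>) powr p / p) has_real_derivative
        B * - (p * (1 - \<rho>) powr (p - 1)) / p) (at \<rho>)"
      by (intro DERIV_cdivide DERIV_cmult)
    then have "(u has_real_derivative D + B * - (p * (1 - \<rho>) powr (p - 1)) / p) (at \<rho>)"
      unfolding u_def D_def by (intro DERIV_add stab_deriv r r0)
    moreover have "D + B * - (p * (1 - \<rho>) powr (p - 1)) / p \<le> 0"
      using stab_deriv_le [OF r0 r(2) assms(1,2), of f n] assms by (simp add: D_def B_def)
    ultimately show "\<exists>y. (u has_real_derivative y) (at \<rho>) \<and> y \<le> 0" by blast
  qed
  \<comment> \<open>At 1 the added term vanishes because \<open>0 powr p = 0\<close>, so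
    \<open>u 1 = 1\<close>.\<close>
  then show ?thesis using assms by (simp add: u_def stab_one B_def)
qed

section \<open>Agreement probability of a correlated pair\<close>

lemma pmf_noisy_bit:
  assumes "0 \<le> \<epsilon>" "\<epsilon> \<le> 1"
  shows "pmf (noisy_bit \<epsilon> a) b = kern (1 - \<epsilon>) a b"
  using assms unfolding noisy_bit_def
  by (simp add: pmf_bind kern_def agree_def field_simps split: split_indicator)

text \<open>The indicator of \<open>f x = f y\<close> is
  \<open>(1 + spin (f x) * spin (f y)) / 2\<close>; the constant term averages to 1/2 and the
  product to half the stability.\<close>

lemma prob_correlated_pair:
  assumes "0 \<le> \<epsilon>" "\<epsilon> \<le> 1"
  shows "measure_pmf.prob (correlated_pair n \<epsilon>) {(x, y). f x = f y} = (1 + stab n f (1 - \<epsilon>)) / 2"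
proof -
  let ?N = "\<lambda>x. Pi_pmf {1..n} False (\<lambda>i. noisy_bit \<epsilon> (x i))"
  \<comment> \<open>The support lies in the cube, so the expectations below become finite sums over
    it.\<close>
  have set: "set_pmf (?N x) \<subseteq> cube n" for x
    using set_Pi_pmf_subset' [of "{1..n}" False "\<lambda>i. noisy_bit \<epsilon> (x i)"]
    by (auto simp: cube_def PiE_dflt_def)
  have fin: "finite (set_pmf (?N x))" for x
    using set finite_cube finite_subset by blast
  have pmf: "pmf (?N x) y = cube_kern n (1 - \<epsilon>) x y" if "y \<in> cube n" for x y
    using that assms by (subst pmf_Pi') (auto simp: cube_def PiE_dflt_def cube_kern_def pmf_noisy_bit)
  have scale: "s /\<^sub>R real (2 ^ n) = s / 2 ^ n" for s :: real
    by (simp add: divide_inverse mult.commute)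
  have split: "(\<Sum>y\<in>cube n. (1 + spin (f x) * spin (f y)) / 2 * K y) =
      ((\<Sum>y\<in>cube n. K y) + (\<Sum>y\<in>cube n. spin (f x) * spin (f y) * K y)) / 2" for x K
    unfolding sum.distrib [symmetric] sum_divide_distrib
    by (intro sum.cong refl) (simp add: algebra_simps)
  have avg: "(\<Sum>x\<in>cube n. (a x + b x) / 2 / c) =
      ((\<Sum>x\<in>cube n. a x) / c + (\<Sum>x\<in>cube n. b x) / c) / 2"
    for a b :: "(nat \<Rightarrow> bool) \<Rightarrow> real" and c
    by (simp add: sum.distrib add_divide_distrib sum_divide_distrib mult.commute)
  have "measure_pmf.prob (correlated_pair n \<epsilon>) {(x, y). f x = f y} =
      measure_pmf.expectation (correlated_pair n \<epsilon>) (indicator {(x, y). f x = f y})"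
    by simp
  also have "\<dots> = (\<Sum>x\<in>cube n. measure_pmf.expectation (?N x \<bind> (\<lambda>y. return_pmf (x, y)))
      (indicator {(x, y). f x = f y} :: _ \<Rightarrow> real) /\<^sub>R real (card (cube n)))"
    unfolding correlated_pair_def using fin by (subst pmf_expectation_bind_pmf_of_set) auto
  also have "\<dots> = (\<Sum>x\<in>cube n. (\<Sum>y\<in>cube n. (1 + spin (f x) * spin (f y)) / 2 *
      cube_kern n (1 - \<epsilon>) x y) / 2 ^ n)"
  proof (intro sum.cong refl)
    fix x
    have "measure_pmf.expectation (?N x \<bind> (\<lambda>y. return_pmf (x, y)))
        (indicator {(x, y). f x = f y} :: _ \<Rightarrow> real) =
        (\<Sum>y\<in>cube n. pmf (?N x) y *\<^sub>R indicator {(x, y). f x = f y} (x, y))"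
      using set fin by (subst pmf_expectation_bind [of "cube n"]) auto
    also have "\<dots> = (\<Sum>y\<in>cube n. (1 + spin (f x) * spin (f y)) / 2 * cube_kern n (1 - \<epsilon>) x y)"
      by (intro sum.cong refl) (auto simp: pmf [simplified] spin_def)
    finally show "measure_pmf.expectation (?N x \<bind> (\<lambda>y. return_pmf (x, y)))
        (indicator {(x, y). f x = f y} :: _ \<Rightarrow> real) /\<^sub>R real (card (cube n)) =
        (\<Sum>y\<in>cube n. (1 + spin (f x) * spin (f y)) / 2 * cube_kern n (1 - \<epsilon>) x y) / 2 ^ n"
      by (simp only: card_cube scale)
  qed
  also have "\<dots> = ((\<Sum>x\<in>cube n. \<Sum>y\<in>cube n. cube_kern n (1 - \<epsilon>) x y) / 2 ^ n +
      stab n f (1 - \<epsilon>)) / 2"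
    unfolding split avg stab_def ..
  also have "\<dots> = (1 + stab n f (1 - \<epsilon>)) / 2"
    by (simp add: sum_cube_kern card_cube)
  finally show ?thesis .
qed

theorem mainTheorem6:
  fixes p :: real
  assumes "1 / 2 \<le> p" and "p < 1"
  shows "\<exists>C>0. \<forall>(n::nat) (A::real) (f :: (nat \<Rightarrow> bool) \<Rightarrow> bool).
           n \<ge> 1 \<longrightarrow> A > 0 \<longrightarrow>
           measure_pmf.expectation (pmf_of_set (cube n)) (\<lambda>x. real (sensitivity n f x) powr p) \<le> A \<longrightarrow>
           (\<forall>\<epsilon>::real. 0 < \<epsilon> \<and> \<epsilon> \<le> 1 \<longrightarrow>
              measure_pmf.prob (correlated_pair n \<epsilon>) {(x, y). f x = f y} \<ge> 1 - C * A * \<epsilon> powr p)"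
proof (intro exI [of _ 1] conjI allI impI)
  fix n :: nat and A :: real and f :: "(nat \<Rightarrow> bool) \<Rightarrow> bool" and \<epsilon> :: real
  assume A: "A > 0"
    and E: "measure_pmf.expectation (pmf_of_set (cube n)) (\<lambda>x. real (sensitivity n f x) powr p) \<le> A"
    and \<epsilon>: "0 < \<epsilon> \<and> \<epsilon> \<le> 1"
  have "(\<Sum>x\<in>cube n. real (sensitivity n f x) powr p) / 2 ^ n \<le> A"
    using E by (simp add: integral_pmf_of_set card_cube)
  then have "(\<Sum>x\<in>cube n. real (sensitivity n f x) powr p) / 2 ^ n * \<epsilon> powr p / p \<le>
      A * \<epsilon> powr p / p"
    using assms by (intro divide_right_mono mult_right_mono) auto
  \<comment> \<open>The bound \<open>1 / p \<le> 2\<close> removes the dependence on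
    \<open>p\<close>; the factor 2 cancels against the half in \<open>prob_correlated_pair\<close>,
    leaving the constant 1.\<close>
  also have "\<dots> \<le> A * \<epsilon> powr p / (1 / 2)"
    using assms A by (intro divide_left_mono) auto
  finally have "1 - stab n f (1 - \<epsilon>) \<le> 2 * (A * \<epsilon> powr p)"
    using one_minus_stab_le [of p \<epsilon> n f] assms \<epsilon> by simp
  then show "1 - 1 * A * \<epsilon> powr p \<le> measure_pmf.prob (correlated_pair n \<epsilon>) {(x, y). f x = f y}"
    using \<epsilon> by (simp add: prob_correlated_pair)
qed simp

end
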